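(* Let $f\in L^p(\mathbb{R})$ for some $1\le p<\infty$. Define $$\Psi_f(s)=\int_{-\infty}^\infty\left(\frac{1-e^{-ist}}{it}\right)f(t)\,dt\qquad\text{for } s\in\mathbb{R}.$$ Let $1/p+1/q=1$; if $p=1$ then $q=\infty$. Let $C_q=4^{1/q}\left(\int_0^\infty\left|\sin(t)/t\right|^q dt\right)^{1/q}$, with $C_\infty=1$. (a) For all $s\in\mathbb{R}$, $|\Psi_f(s)|\le C_q\|f\|_p|s|^{1/p}$. (b) For $1<p<\infty$, this estimate is sharp in the limit $|s|\to\infty$ in the sense that if $\psi:\mathbb{R}\to(0,\infty)$ is any function such that $\psi(s)=o(|s|^{1/p})$ as $|s|\to\infty$ then there is $f\in L^p(\mathbb{R})$ such that $\Psi_f(s)/\psi(s)$ is not bounded as $|s|\to\infty$. In a similar manner the estimate is sharp in the limit $s\to0$. Also, the constant $C_q$ cannot be replaced with any smaller number. (c) For $p=1$ the estimate $|\Psi_f(s)|\le\|f\|_1|s|$ is sharp in the limit $s\to0$. And, $\Psi_f(s)=o(s)$ as $|s|\to\infty$. (d) $\Psi_f$ is Hölder continuous on $\mathbb{R}$ with exponent $1/p$ and hence uniformly continuous on $\mathbb{R}$. When $p=1$ the function $\Psi_f$ is Lipschitz continuous on $\mathbb{R}$.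
   Context: $L^p(\mathbb{R})$ is the usual Lebesgue space on the real line with respect to Lebesgue measure, with norm $\|\cdot\|_p$. The kernel $t\mapsto\frac{1-e^{-ist}}{it}$ is given the value $s$ at $t=0$. *)

theory Defs
  imports "HOL-Analysis.Analysis" "HOL-Library.Landau_Symbols"
begin

text \<open>
  Complex-valued functions on the line whose \<open>p\<close>-th power is Lebesgue integrable, for finite
  exponents \<open>p\<close>. Elements are functions rather than classes modulo null sets, so
  \<open>Lp_norm p\<close> is only a seminorm. The scalars have to be complex: for real-valued functions and \<open>p > 1\<close>
  the constant \<open>C_const q\<close> below is not optimal.
\<close>

definition Lp_space :: "real \<Rightarrow> (real \<Rightarrow> complex) set" where
  "Lp_space p = {f. f \<in> borel_measurable lebesgue \<and>
                    integrable lebesgue (\<lambda>t. norm (f t) powr p)}"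

definition Lp_norm :: "real \<Rightarrow> (real \<Rightarrow> complex) \<Rightarrow> real" where
  "Lp_norm p f = (LINT t|lebesgue. norm (f t) powr p) powr (1 / p)"

definition Psi_kernel :: "real \<Rightarrow> real \<Rightarrow> complex" where
  "Psi_kernel s t =
     (if t = 0 then of_real s
      else (1 - exp (- (\<i> * of_real s * of_real t))) / (\<i> * of_real t))"

definition Psi :: "(real \<Rightarrow> complex) \<Rightarrow> real \<Rightarrow> complex" where
  "Psi f s = (LINT t|lebesgue. Psi_kernel s t * f t)"

text \<open>
  The value of the integrand at \<open>t = 0\<close>, where \<open>sin t / t\<close> is \<open>0\<close> by the convention on
  division, does not affect the integral.
\<close>

definition C_const :: "ennreal \<Rightarrow> real" where
  "C_const q =
     (if q = \<infinity> then 1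
      else 4 powr (1 / enn2real q) *
           (LINT t:{0..}|lebesgue. \<bar>sin t / t\<bar> powr enn2real q) powr (1 / enn2real q))"

definition Hoelder_continuous :: "real \<Rightarrow> (real \<Rightarrow> complex) \<Rightarrow> bool" where
  "Hoelder_continuous \<alpha> g \<longleftrightarrow> (\<exists>C. \<forall>x y. norm (g x - g y) \<le> C * \<bar>x - y\<bar> powr \<alpha>)"

text \<open>
  Sharpness of the order of the estimate \<open>|\<Psi>\<^sub>f(s)| \<le> C \<parallel>f\<parallel>\<^sub>p |s|\<^sup>1\<^sup>/\<^sup>p\<close> in the limit described by the
  filter \<open>F\<close>. For \<open>|s| \<rightarrow> \<infinity>\<close> the filter is \<open>at_infinity\<close>, and \<open>Bfun g F\<close> says that
  \<open>g\<close> is eventually bounded along \<open>F\<close>.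
\<close>

definition Psi_order_sharp :: "real \<Rightarrow> real filter \<Rightarrow> bool" where
  "Psi_order_sharp p F \<longleftrightarrow>
     (\<forall>\<psi> :: real \<Rightarrow> real. (\<forall>s. \<psi> s > 0) \<and> \<psi> \<in> o[F](\<lambda>s. \<bar>s\<bar> powr (1 / p)) \<longrightarrow>
        (\<exists>f \<in> Lp_space p. \<not> Bfun (\<lambda>s. Psi f s / of_real (\<psi> s)) F))"

end

theory Submission
  imports Defs
begin

text \<open>
  By scaling, the \<open>L\<^sup>q\<close> norm of the kernel \<open>K(s, \<cdot>)\<close> is exactly \<open>C\<^sub>q \<bar>s\<bar>\<^sup>1\<^sup>/\<^sup>p\<close>, so the estimate is Hoelder's
  inequality and its equality case shows that \<open>C\<^sub>q\<close> is optimal. Since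
  \<open>K(x, t) - K(y, t) = e\<^sup>-\<^sup>i\<^sup>y\<^sup>t K(x - y, t)\<close>, the difference \<open>\<Psi>\<^sub>f(x) - \<Psi>\<^sub>f(y)\<close> is the transform at
  \<open>x - y\<close> of a function with the same norm as \<open>f\<close>, which gives Hoelder continuity. That the order
  is sharp follows from the positivity of \<open>- Im K(s, t)\<close> for \<open>t > 0\<close>, which lets one add up
  test functions adapted to a sequence of points \<open>s\<^sub>n\<close> without cancellation. For \<open>p = 1\<close> both limits
  of \<open>\<Psi>\<^sub>f(s) / s\<close> come from dominated convergence.
\<close>

section \<open>Hoelder's inequality for Bochner integrals\<close>

text \<open>Young's inequality bounds the product pointwise, which gives integrability; applied to
  the normalised functions and integrated, it yields the factor
  \<open>1 / p + 1 / q = 1\<close>.\<close>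

lemma Hoelder_integral:
  fixes f g :: "'a \<Rightarrow> 'b::{real_normed_field, banach, second_countable_topology}"
  assumes "p > 1" "1 / p + 1 / q = 1"
    and [measurable]: "f \<in> borel_measurable M" "g \<in> borel_measurable M"
    and f: "integrable M (\<lambda>x. norm (f x) powr p)" and g: "integrable M (\<lambda>x. norm (g x) powr q)"
  shows "integrable M (\<lambda>x. f x * g x)" (is ?int)
    and "norm (\<integral>x. f x * g x \<partial>M)
      \<le> (\<integral>x. norm (f x) powr p \<partial>M) powr (1 / p) * (\<integral>x. norm (g x) powr q \<partial>M) powr (1 / q)" (is ?le)
proof -
  have "1 / p < 1" using \<open>p > 1\<close> by simp
  then have "1 / q > 0" using assms(2) by linarith
  then have "q > 0" by simp
  have "1 / p > 0" using \<open>p > 1\<close> by simp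
  then have "1 / q < 1" using assms(2) by linarith
  then have "q > 1" using \<open>q > 0\<close> by (simp add: field_simps)
  note Young = Youngs_inequality[OF \<open>p > 1\<close> \<open>q > 1\<close> assms(2)]
  show ?int
  proof (rule Bochner_Integration.integrable_bound)
    show "integrable M (\<lambda>x. norm (f x) powr p / p + norm (g x) powr q / q)"
      using f g by simp
    show "AE x in M. norm (f x * g x) \<le> norm (norm (f x) powr p / p + norm (g x) powr q / q)"
      using Young \<open>p > 1\<close> \<open>q > 1\<close> by (auto simp: norm_mult)
  qed measurable
  define A where "A = (\<integral>x. norm (f x) powr p \<partial>M)"
  define B where "B = (\<integral>x. norm (g x) powr q \<partial>M)"
  have "A \<ge> 0" "B \<ge> 0" unfolding A_def B_def by (auto intro: integral_nonneg_AE)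
  \<comment> \<open>Normalisation divides by the two norms, so a vanishing norm is treated apart:
    then one factor, hence the product, is zero almost everywhere.\<close>
  then consider "A = 0" | "B = 0" | "A > 0" "B > 0" by linarith
  then have "norm (\<integral>x. f x * g x \<partial>M) \<le> A powr (1 / p) * B powr (1 / q)"
  proof cases
    case 1
    then have "AE x in M. norm (f x) powr p = 0"
      using f unfolding A_def by (subst (asm) integral_nonneg_eq_0_iff_AE) auto
    then have "AE x in M. f x * g x = 0" by eventually_elim auto
    then have "(\<integral>x. f x * g x \<partial>M) = 0" by (rule integral_eq_zero_AE)
    then show ?thesis by simp
  next
    case 2
    then have "AE x in M. norm (g x) powr q = 0"
      using g unfolding B_def by (subst (asm) integral_nonneg_eq_0_iff_AE) auto
    then have "AE x in M. f x * g x = 0" by eventually_elim auto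
    then have "(\<integral>x. f x * g x \<partial>M) = 0" by (rule integral_eq_zero_AE)
    then show ?thesis by simp
  next
    case 3
    define a where "a = A powr (1 / p)"
    define b where "b = B powr (1 / q)"
    have ab: "a > 0" "b > 0" "a powr p = A" "b powr q = B"
      using 3 \<open>p > 1\<close> \<open>q > 1\<close> by (auto simp: a_def b_def powr_powr)
    \<comment> \<open>Young's inequality for \<open>norm (f x) / a\<close> and
      \<open>norm (g x) / b\<close>, multiplied back by \<open>a * b\<close>.\<close>
    have pw: "norm (f x * g x) \<le> a * b * (norm (f x) powr p / (p * A) + norm (g x) powr q / (q * B))" for x
    proof -
      have "norm (f x) / a * (norm (g x) / b)
        \<le> (norm (f x) / a) powr p / p + (norm (g x) / b) powr q / q"
        using ab by (intro Young) auto
      also have "\<dots> = norm (f x) powr p / (p * A) + norm (g x) powr q / (q * B)"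
        using ab by (simp add: powr_divide mult.commute)
      finally show ?thesis using ab by (simp add: norm_mult field_simps)
    qed
    have "norm (\<integral>x. f x * g x \<partial>M)
      \<le> (\<integral>x. a * b * (norm (f x) powr p / (p * A) + norm (g x) powr q / (q * B)) \<partial>M)"
      using f g pw \<open>?int\<close> by (intro order.trans[OF integral_norm_bound] integral_mono) auto
    also have "\<dots> = a * b * (A / (p * A) + B / (q * B))"
      using f g by (simp add: A_def B_def)
    also have "\<dots> = a * b" using assms(2) 3 by simp
    finally show ?thesis by (simp add: a_def b_def)
  qed
  then show ?le unfolding A_def B_def .
qed

section \<open>Elementary properties of the kernel\<close>

lemma Psi_kernel_measurable [measurable]: "Psi_kernel s \<in> borel_measurable borel"
  unfolding Psi_kernel_def by measurable

lemma Psi_kernel_measurable_lebesgue [measurable]: "Psi_kernel s \<in> borel_measurable lebesgue"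
  by (rule measurable_completion) simp

text \<open>This is \<open>|exp (i x) - 1| = 2 |sin (x / 2)|\<close> with
  \<open>x = - s t\<close>.\<close>

lemma norm_Psi_kernel:
  assumes "t \<noteq> 0"
  shows "norm (Psi_kernel s t) = \<bar>2 * sin (s * t / 2) / t\<bar>"
proof -
  have "norm (Psi_kernel s t) = norm (exp (\<i> * of_real (- (s * t))) - 1) / \<bar>t\<bar>"
    using assms by (simp add: Psi_kernel_def norm_divide norm_mult norm_minus_commute mult.assoc)
  also have "\<dots> = \<bar>2 * sin (s * t / 2) / t\<bar>"
    by (simp only: dist_exp_i_1) (simp add: abs_mult)
  finally show ?thesis .
qed

text \<open>The sup bound on the kernel: it is the Hoelder estimate for
  \<open>q = \<infinity>\<close> and later supplies the dominating function for
  \<open>p = 1\<close>.\<close>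

lemma norm_Psi_kernel_le: "norm (Psi_kernel s t) \<le> \<bar>s\<bar>"
proof (cases "t = 0")
  case False
  have "\<bar>sin (s * t / 2)\<bar> \<le> \<bar>s * t / 2\<bar>" by (rule abs_sin_x_le_abs_x)
  then show ?thesis using False by (simp add: norm_Psi_kernel abs_mult field_simps)
qed (simp add: Psi_kernel_def)

lemma Im_Psi_kernel: "t \<noteq> 0 \<Longrightarrow> - Im (Psi_kernel s t) = (1 - cos (s * t)) / t"
  by (simp add: Psi_kernel_def Im_divide Re_exp Im_exp power2_eq_square)

text \<open>The factor \<open>exp (- i y t)\<close> has modulus 1 and can be absorbed into
  \<open>f\<close>, which turns a difference of transforms into a single transform at
  \<open>x - y\<close>.\<close>

lemma Psi_kernel_diff:
  "Psi_kernel x t - Psi_kernel y t = Psi_kernel (x - y) t * exp (- (\<i> * of_real y * of_real t))"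
proof (cases "t = 0")
  case False
  have "exp (- (\<i> * of_real (x - y) * of_real t)) * exp (- (\<i> * of_real y * of_real t))
     = exp (- (\<i> * of_real x * of_real t))"
    by (simp add: exp_add[symmetric] algebra_simps)
  then show ?thesis using False by (simp add: Psi_kernel_def diff_divide_distrib[symmetric] algebra_simps)
qed (simp add: Psi_kernel_def)

section \<open>The norm of the kernel\<close>

text \<open>The integrand is at most 1 on \<open>[0, 1)\<close> and at most
  \<open>t powr (- r)\<close> on \<open>[1, \<infinity>)\<close>, which is integrable there because
  \<open>r > 1\<close>.\<close>

lemma integrable_sinc_powr:
  fixes r :: real
  assumes "r > 1"
  shows "integrable lborel (\<lambda>t. indicator {0..} t * \<bar>sin t / t\<bar> powr r)"
proof (rule Bochner_Integration.integrable_bound)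
  have "(\<lambda>t. t powr (- r)) absolutely_integrable_on {1..}"
    using has_integral_powr_to_inf[of "- r" 1] assms
    by (intro nonnegative_absolutely_integrable_1) (auto simp: has_integral_iff)
  then have "integrable lborel (\<lambda>t. indicator {1..} t * t powr (- r))"
    by (simp add: set_integrable_def integrable_completion)
  moreover have "integrable lborel (indicator {0..<1::real} :: real \<Rightarrow> real)" by simp
  ultimately show "integrable lborel (\<lambda>t. indicator {0..<1::real} t + indicator {1..} t * t powr (- r))"
    by (rule Bochner_Integration.integrable_add[rotated])
  show "AE t in lborel. norm (indicator {0..} t * \<bar>sin t / t\<bar> powr r)
      \<le> norm (indicator {0..<1::real} t + indicator {1..} t * t powr (- r))"
  proof (rule AE_I2)
    fix t :: real
    consider "t < 0" | "0 \<le> t" "t < 1" | "t \<ge> 1" by linarith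
    then show "norm (indicator {0..} t * \<bar>sin t / t\<bar> powr r)
      \<le> norm (indicator {0..<1::real} t + indicator {1..} t * t powr (- r))"
    proof cases
      case 2
      then have "\<bar>sin t / t\<bar> \<le> 1"
        using abs_sin_x_le_abs_x[of t] by (cases "t = 0") (auto simp: field_simps)
      then have "\<bar>sin t / t\<bar> powr r \<le> 1" using assms by (intro powr_le1) auto
      then show ?thesis using 2 by simp
    next
      case 3
      then have "\<bar>sin t / t\<bar> \<le> 1 / t" by (simp add: divide_right_mono)
      then have "\<bar>sin t / t\<bar> powr r \<le> (1 / t) powr r" using assms by (intro powr_mono2) auto
      also have "\<dots> = t powr (- r)" using 3 by (simp add: powr_divide powr_minus_divide)
      finally show ?thesis using 3 by (simp add: indicator_def)
    qed simp
  qed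
qed measurable

text \<open>The factor \<open>4\<close> in \<^const>\<open>C_const\<close> arises as a \<open>2\<close> from the substitution \<open>t = 2 u / s\<close> and a
  \<open>2\<close> from evenness.\<close>

lemma integral_Psi_kernel_powr:
  fixes r :: real
  assumes "r > 1"
  shows "integrable lebesgue (\<lambda>t. norm (Psi_kernel s t) powr r)" (is ?int)
    and "(LINT t|lebesgue. norm (Psi_kernel s t) powr r) = (C_const (ennreal r) * \<bar>s\<bar> powr (1 - 1 / r)) powr r"
    (is ?eq)
proof -
  define h where "h t = indicator {0..} t * \<bar>sin t / t\<bar> powr r" for t :: real
  have h: "integrable lborel h" unfolding h_def using assms by (rule integrable_sinc_powr)
  define I where "I = (LINT t|lborel. h t)"
  have "I \<ge> 0" unfolding I_def h_def by (rule integral_nonneg_AE) auto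
  have C: "C_const (ennreal r) = 4 powr (1 / r) * I powr (1 / r)"
    using assms by (simp add: C_const_def I_def h_def set_lebesgue_integral_def integral_completion)
  \<comment> \<open>The two halves overlap at \<open>x = 0\<close>, but there
    \<open>sin 0 / 0 = 0\<close> by convention, so both sides vanish.\<close>
  have hh: "\<bar>sin x / x\<bar> powr r = h x + h (- x)" for x
    by (cases x "0 :: real" rule: linorder_cases) (simp_all add: h_def)
  \<comment> \<open>The shape \<open>0 + c * t\<close> matches the affine change of variables for
    \<open>lborel\<close>, used below with \<open>c = s / 2\<close> and
    \<open>c = - (s / 2)\<close>.\<close>
  have K: "norm (Psi_kernel s t) powr r = \<bar>s\<bar> powr r * (h (0 + s / 2 * t) + h (0 + - (s / 2) * t))"
    if "t \<noteq> 0" for t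
  proof -
    have e: "\<bar>2 * sin (s * t / 2) / t\<bar> = \<bar>s\<bar> * \<bar>sin (s / 2 * t) / (s / 2 * t)\<bar>"
      using that by (cases "s = 0") (auto simp: abs_mult)
    have "norm (Psi_kernel s t) powr r = \<bar>s\<bar> powr r * \<bar>sin (s / 2 * t) / (s / 2 * t)\<bar> powr r"
      unfolding norm_Psi_kernel[OF that] e by (rule powr_mult)
    then show ?thesis unfolding hh by simp
  qed
  have AE: "AE t in lborel. \<bar>s\<bar> powr r * (h (0 + s / 2 * t) + h (0 + - (s / 2) * t)) = norm (Psi_kernel s t) powr r"
    using AE_lborel_singleton[of 0] by eventually_elim (use K in auto)
  have "has_bochner_integral lborel (\<lambda>t. \<bar>s\<bar> powr r * (h (0 + s / 2 * t) + h (0 + - (s / 2) * t)))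
      (4 * I * \<bar>s\<bar> powr (r - 1))"
  \<comment> \<open>For \<open>s \<noteq> 0\<close> each half contributes
    \<open>2 * I / |s|\<close>. For \<open>s = 0\<close> both sides are 0, since
    \<open>0 powr r = 0\<close>.\<close>
  proof (cases "s = 0")
    case False
    have "has_bochner_integral lborel (\<lambda>t. h (0 + c * t)) (I / \<bar>c\<bar>)" if "c \<noteq> 0" for c
      using lborel_integrable_real_affine[OF h that, of 0] lborel_integral_real_affine[OF that, of h 0] that
      by (simp add: has_bochner_integral_iff I_def)
    from this[of "s / 2"] this[of "- (s / 2)"] False
    have "has_bochner_integral lborel (\<lambda>t. \<bar>s\<bar> powr r * (h (0 + s / 2 * t) + h (0 + - (s / 2) * t)))
      (\<bar>s\<bar> powr r * (I / \<bar>s / 2\<bar> + I / \<bar>- (s / 2)\<bar>))"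
      by (intro has_bochner_integral_mult_right has_bochner_integral_add) auto
    also have "\<bar>s\<bar> powr r * (I / \<bar>s / 2\<bar> + I / \<bar>- (s / 2)\<bar>) = 4 * I * \<bar>s\<bar> powr (r - 1)"
      using False by (simp add: powr_diff)
    finally show ?thesis .
  qed (simp add: has_bochner_integral_zero)
  then have "has_bochner_integral lborel (\<lambda>t. norm (Psi_kernel s t) powr r) (4 * I * \<bar>s\<bar> powr (r - 1))"
    using h by (subst (asm) has_bochner_integral_cong_AE[OF _ _ AE]) (auto dest: borel_measurable_integrable)
  moreover have "(C_const (ennreal r) * \<bar>s\<bar> powr (1 - 1 / r)) powr r = 4 * I * \<bar>s\<bar> powr (r - 1)"
    using assms \<open>I \<ge> 0\<close> by (simp add: C powr_mult powr_powr algebra_simps)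
  ultimately show ?int ?eq
    by (simp_all add: has_bochner_integral_iff integrable_completion integral_completion)
qed

section \<open>Basic facts on norms and conjugate exponents\<close>

lemma C_const_nonneg: "C_const q \<ge> 0"
  by (simp add: C_const_def)

lemma Lp_norm_nonneg: "Lp_norm p f \<ge> 0"
  by (simp add: Lp_norm_def)

lemma Lp_space_1: "f \<in> Lp_space 1 \<longleftrightarrow> integrable lebesgue f"
  by (auto simp: Lp_space_def integrable_norm_iff borel_measurable_integrable)

lemma Lp_norm_1: "Lp_norm 1 f = (LINT t|lebesgue. norm (f t))"
  by (simp add: Lp_norm_def integral_nonneg_AE)

lemma measurable_Lp_space: "f \<in> Lp_space p \<Longrightarrow> f \<in> borel_measurable lebesgue"
  by (simp add: Lp_space_def)

text \<open>Passes from the extended exponent \<open>q\<close> to a real one: \<open>p > 1\<close>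
  puts \<open>1 / q\<close> strictly between 0 and 1, so inverting it gives a finite number above
  1.\<close>

lemma conjugate_exponent:
  fixes p :: real and q :: ennreal
  assumes "1 < p" "1 / ennreal p + 1 / q = 1"
  shows "\<exists>r>1. q = ennreal r \<and> 1 / p + 1 / r = 1"
proof -
  have q: "1 / q = ennreal (1 - 1 / p)"
  proof -
    have "1 / ennreal p = ennreal (1 / p)" using assms by (simp add: divide_ennreal flip: ennreal_1)
    then have "ennreal (1 / p) + 1 / q = ennreal (1 / p) + ennreal (1 - 1 / p)"
      using assms by (simp flip: ennreal_plus)
    then show ?thesis by (simp add: ennreal_add_left_cancel)
  qed
  have "1 - 1 / p > 0" using assms by simp
  \<comment> \<open>Inversion is an involution on all of \<open>ennreal\<close>, with 0 and
    \<open>\<infinity>\<close> interchanged.\<close>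
  moreover have "q = 1 / (1 / q)"
  proof (cases q)
    case (real a)
    then show ?thesis by (cases "a = 0") (auto simp: divide_ennreal_def inverse_ennreal)
  qed (simp add: divide_ennreal_def)
  ultimately have "q = ennreal (1 / (1 - 1 / p))"
    unfolding q by (simp add: divide_ennreal flip: ennreal_1)
  moreover have "1 / (1 - 1 / p) > 1" using assms by (simp add: field_simps)
  moreover have "1 / p + 1 / (1 / (1 - 1 / p)) = 1" by simp
  ultimately show ?thesis by blast
qed

lemma conjugate_exponent_1:
  fixes q :: ennreal
  assumes "1 / ennreal 1 + 1 / q = 1"
  shows "q = \<infinity>"
proof -
  have "1 + 1 / q = 1 + 0" using assms by simp
  then have "1 / q = 0" unfolding ennreal_add_left_cancel by simp
  then show ?thesis by (simp add: divide_ennreal_def ennreal_inverse_eq_0_iff)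
qed

section \<open>The estimate for the transform and its differences\<close>

text \<open>The sup bound on the kernel settles \<open>p = 1\<close>; otherwise Hoelder's inequality
  meets the exact norm of the kernel, with \<open>1 - 1 / r = 1 / p\<close>. Integrability is a
  separate claim because a Bochner integral that fails to exist is 0 by default.\<close>

proposition Psi_bound:
  assumes "1 \<le> p" "1 / ennreal p + 1 / q = 1" "f \<in> Lp_space p"
  shows "integrable lebesgue (\<lambda>t. Psi_kernel s t * f t)"
    and "norm (Psi f s) \<le> C_const q * Lp_norm p f * \<bar>s\<bar> powr (1 / p)"
proof -
  have [measurable]: "f \<in> borel_measurable lebesgue" using assms(3) by (rule measurable_Lp_space)
  have "integrable lebesgue (\<lambda>t. Psi_kernel s t * f t)
    \<and> norm (Psi f s) \<le> C_const q * Lp_norm p f * \<bar>s\<bar> powr (1 / p)"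
  proof (cases "p = 1")
    case True
    then have f: "integrable lebesgue f" using assms by (simp add: Lp_space_1)
    have q: "q = \<infinity>" using assms True conjugate_exponent_1 by simp
    have le: "norm (Psi_kernel s t * f t) \<le> \<bar>s\<bar> * norm (f t)" for t
      by (simp add: norm_mult mult_right_mono norm_Psi_kernel_le)
    have int: "integrable lebesgue (\<lambda>t. Psi_kernel s t * f t)"
      by (rule Bochner_Integration.integrable_bound[where f = "\<lambda>t. \<bar>s\<bar> * norm (f t)"])
        (use f le in \<open>auto intro: borel_measurable_times\<close>)
    have "norm (Psi f s) \<le> (LINT t|lebesgue. \<bar>s\<bar> * norm (f t))"
      unfolding Psi_def using f le int by (intro order.trans[OF integral_norm_bound] integral_mono) auto
    also have "\<dots> = C_const q * Lp_norm p f * \<bar>s\<bar> powr (1 / p)"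
      by (simp add: Lp_norm_1 True q C_const_def mult.commute)
    finally show ?thesis using int by simp
  next
    case False
    then have "p > 1" using assms by simp
    then obtain r where r: "r > 1" "q = ennreal r" "1 / p + 1 / r = 1"
      using conjugate_exponent assms by blast
    then have "1 / r + 1 / p = 1" "1 - 1 / r = 1 / p" by simp_all
    note K = integral_Psi_kernel_powr[OF \<open>r > 1\<close>, of s]
    have Kr: "(LINT t|lebesgue. norm (Psi_kernel s t) powr r) powr (1 / r) = C_const q * \<bar>s\<bar> powr (1 / p)"
      using r C_const_nonneg[of "ennreal r"] \<open>1 - 1 / r = 1 / p\<close> by (simp add: K powr_powr)
    have f: "integrable lebesgue (\<lambda>t. norm (f t) powr p)" using assms by (simp add: Lp_space_def)
    \<comment> \<open>The kernel is the first factor, so the exponents enter as \<open>r\<close> and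
      then \<open>p\<close>.\<close>
    show ?thesis
      using Hoelder_integral[OF \<open>r > 1\<close> \<open>1 / r + 1 / p = 1\<close>, of "Psi_kernel s" lebesgue f] K(1) f
      by (simp add: Kr Psi_def Lp_norm_def mult_ac)
  qed
  then show "integrable lebesgue (\<lambda>t. Psi_kernel s t * f t)"
    and "norm (Psi f s) \<le> C_const q * Lp_norm p f * \<bar>s\<bar> powr (1 / p)" by auto
qed

text \<open>By \<open>Psi_kernel_diff\<close> the difference is \<open>Psi g (x - y)\<close> for a
  modulation \<open>g\<close> of \<open>f\<close>, and modulation preserves the norm.\<close>

lemma norm_Psi_diff_le:
  assumes "1 \<le> p" "1 / ennreal p + 1 / q = 1" "f \<in> Lp_space p"
  shows "norm (Psi f x - Psi f y) \<le> C_const q * Lp_norm p f * \<bar>x - y\<bar> powr (1 / p)"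
proof -
  define g where "g t = exp (- (\<i> * of_real y * of_real t)) * f t" for t
  have [measurable]: "f \<in> borel_measurable lebesgue" using assms(3) by (rule measurable_Lp_space)
  have e: "norm (exp (- (\<i> * of_real y * complex_of_real t))) = 1" for t
    by (simp add: norm_exp_eq_Re)
  have [measurable]: "(\<lambda>t. exp (- (\<i> * of_real y * complex_of_real t))) \<in> borel_measurable lebesgue"
    by (rule measurable_completion) simp
  have g: "norm (g t) = norm (f t)" for t by (simp add: g_def norm_mult e)
  have [measurable]: "g \<in> borel_measurable lebesgue" unfolding g_def by measurable
  have gL: "g \<in> Lp_space p" "Lp_norm p g = Lp_norm p f"
    using assms(3) by (auto simp: Lp_space_def Lp_norm_def g)
  have "Psi f x - Psi f y = (LINT t|lebesgue. Psi_kernel x t * f t - Psi_kernel y t * f t)"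
    unfolding Psi_def using Psi_bound(1)[OF assms] by simp
  also have "\<dots> = Psi g (x - y)"
    unfolding Psi_def g_def by (simp only: left_diff_distrib[symmetric] Psi_kernel_diff mult.assoc)
  finally show ?thesis using Psi_bound(2)[OF assms(1,2) gL(1), of "x - y"] gL(2) by simp
qed

section \<open>Sharpness of the order\<close>

text \<open>As \<open>- Im K(s, t) = (1 - cos (s t)) / t\<close> is nonnegative for \<open>t > 0\<close>, it suffices that \<open>f\<^sup>p\<close> dominates
  \<open>2\<^sup>-\<^sup>n s\<^sub>n\<close> on \<open>[1/s\<^sub>n, 2/s\<^sub>n]\<close>, where \<open>\<psi>(s\<^sub>n) \<le> 4\<^sup>-\<^sup>n s\<^sub>n\<^sup>1\<^sup>/\<^sup>p\<close>.\<close>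

proposition Psi_order_sharpI:
  fixes \<sigma> :: "nat \<Rightarrow> real"
  assumes p: "1 \<le> p" "1 / ennreal p + 1 / q = 1"
    and pos: "\<And>n. \<sigma> n > 0" and \<sigma>: "filterlim \<sigma> F sequentially"
  shows "Psi_order_sharp p F"
  unfolding Psi_order_sharp_def
proof (intro allI impI)
  fix \<psi> :: "real \<Rightarrow> real"
  assume "(\<forall>s. \<psi> s > 0) \<and> \<psi> \<in> o[F](\<lambda>s. \<bar>s\<bar> powr (1 / p))"
  then have \<psi>: "\<And>s. \<psi> s > 0" "\<psi> \<in> o[F](\<lambda>s. \<bar>s\<bar> powr (1 / p))" by auto
  \<comment> \<open>The decay \<open>4^-n\<close> of \<open>\<psi>\<close> is chosen to beat the
    summable weights \<open>2^-n\<close> used for \<open>f\<close>; the quotient \<open>2^n\<close>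
    will be unbounded. The condition \<open>m \<ge> n\<close> keeps the chosen points converging
    along \<open>F\<close>.\<close>
  have "\<exists>m\<ge>n. \<psi> (\<sigma> m) \<le> (1 / 4) ^ n * \<sigma> m powr (1 / p)" for n
  proof -
    have "eventually (\<lambda>s. norm (\<psi> s) \<le> (1 / 4) ^ n * norm (\<bar>s\<bar> powr (1 / p))) F"
      by (rule landau_o.smallD[OF \<psi>(2)]) simp
    then have "eventually (\<lambda>m. norm (\<psi> (\<sigma> m)) \<le> (1 / 4) ^ n * norm (\<bar>\<sigma> m\<bar> powr (1 / p))) sequentially"
      using \<sigma> by (auto simp: filterlim_iff)
    with eventually_ge_at_top[of n]
    have "eventually (\<lambda>m. n \<le> m \<and> \<psi> (\<sigma> m) \<le> (1 / 4) ^ n * \<sigma> m powr (1 / p)) sequentially"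
      by eventually_elim (use pos in \<open>auto simp: less_imp_le\<close>)
    then show ?thesis by (auto simp: eventually_sequentially)
  qed
  then obtain m where m: "\<And>n. m n \<ge> n" "\<And>n. \<psi> (\<sigma> (m n)) \<le> (1 / 4) ^ n * \<sigma> (m n) powr (1 / p)"
    by metis
  define s where "s n = \<sigma> (m n)" for n
  have s_pos: "s n > 0" for n by (simp add: s_def pos)
  have \<psi>s: "\<psi> (s n) \<le> (1 / 4) ^ n * s n powr (1 / p)" for n by (simp add: s_def m)
  have "filterlim m at_top sequentially"
    by (rule filterlim_at_top_mono[OF filterlim_ident]) (simp add: m)
  then have s_lim: "filterlim s F sequentially"
    unfolding s_def by (rule filterlim_compose[OF \<sigma>])

  define A where "A n = {1 / s n..2 / s n}" for n
  \<comment> \<open>With values in \<open>ennreal\<close> the series makes sense everywhere, even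
    where the intervals overlap. Since \<open>A n\<close> has length \<open>1 / s n\<close>, the
    \<open>n\<close>-th term has integral \<open>2^-n\<close>.\<close>
  define G where "G t = (\<Sum>n. ennreal ((1 / 2) ^ n * s n) * indicator (A n) t)" for t
  have [measurable]: "A n \<in> sets borel" for n by (simp add: A_def)
  have [measurable]: "G \<in> borel_measurable borel" unfolding G_def by measurable
  have G_int: "(\<integral>\<^sup>+t. G t \<partial>lborel) < \<infinity>"
  proof -
    have "(\<integral>\<^sup>+t. G t \<partial>lborel) = (\<Sum>n. \<integral>\<^sup>+t. ennreal ((1 / 2) ^ n * s n) * indicator (A n) t \<partial>lborel)"
      unfolding G_def by (rule nn_integral_suminf) simp
    also have "\<dots> = (\<Sum>n. ennreal ((1 / 2) ^ n))"
    proof (rule suminf_cong)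
      fix n
      have "(\<integral>\<^sup>+t. ennreal ((1 / 2) ^ n * s n) * indicator (A n) t \<partial>lborel)
        = ennreal ((1 / 2) ^ n * s n) * ennreal (2 / s n - 1 / s n)"
        using s_pos[of n] by (simp add: nn_integral_cmult A_def divide_right_mono)
      also have "\<dots> = ennreal ((1 / 2) ^ n * s n * (2 / s n - 1 / s n))"
        using s_pos[of n] by (subst ennreal_mult) (auto simp: field_simps)
      finally show "(\<integral>\<^sup>+t. ennreal ((1 / 2) ^ n * s n) * indicator (A n) t \<partial>lborel) = ennreal ((1 / 2) ^ n)"
        using s_pos[of n] by (simp add: field_simps)
    qed
    also have "\<dots> = ennreal (\<Sum>n. (1 / 2) ^ n)"
      by (rule suminf_ennreal2) (auto intro: summable_geometric)
    finally show ?thesis by simp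
  qed
  \<comment> \<open>\<open>enn2real\<close> sends \<open>\<infinity>\<close> to 0, so
    \<open>g\<close> lies below \<open>G\<close> everywhere but dominates the single terms only
    where \<open>G\<close> is finite, that is almost everywhere.\<close>
  define g where "g t = enn2real (G t)" for t
  have [measurable]: "g \<in> borel_measurable borel" unfolding g_def by measurable
  have g_nonneg: "g t \<ge> 0" for t by (simp add: g_def)
  have fin: "AE t in lborel. G t \<noteq> \<infinity>"
    by (rule nn_integral_noteq_infinite) (use G_int in auto)
  have g_int: "integrable lborel g"
  proof (rule integrableI_nonneg)
    have "(\<integral>\<^sup>+t. ennreal (g t) \<partial>lborel) \<le> (\<integral>\<^sup>+t. G t \<partial>lborel)"
      unfolding g_def by (rule nn_integral_mono) (simp add: ennreal_enn2real_if)
    then show "(\<integral>\<^sup>+t. ennreal (g t) \<partial>lborel) < \<infinity>" using G_int by (rule le_less_trans)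
  qed (use g_nonneg in auto)
  have g_ge: "AE t in lborel. \<forall>n. t \<in> A n \<longrightarrow> (1 / 2) ^ n * s n \<le> g t"
    using fin
  proof eventually_elim
    case (elim t)
    show ?case
    proof (intro allI impI)
      fix n assume t: "t \<in> A n"
      have "(\<Sum>k\<in>{n}. ennreal ((1 / 2) ^ k * s k) * indicator (A k) t) \<le> G t"
        unfolding G_def by (rule sum_le_suminf) auto
      then have "ennreal ((1 / 2) ^ n * s n) \<le> G t" using t by simp
      then have "enn2real (ennreal ((1 / 2) ^ n * s n)) \<le> g t"
        unfolding g_def using elim by (intro enn2real_mono) (auto simp: top.not_eq_extremum)
      then show "(1 / 2) ^ n * s n \<le> g t" using s_pos[of n] by simp
    qed
  qed
  \<comment> \<open>On the negative half-line \<open>- Im\<close> of the kernel has the wrong sign,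
    so \<open>g\<close> has to vanish there.\<close>
  have g_neg: "g t = 0" if "t \<le> 0" for t
  proof -
    have "t \<notin> A n" for n
    proof -
      have "0 < 1 / s n" using s_pos[of n] by simp
      then show ?thesis using that unfolding A_def atLeastAtMost_iff by linarith
    qed
    then show ?thesis by (simp add: g_def G_def)
  qed

  define f where "f t = complex_of_real (g t powr (1 / p))" for t
  have [measurable]: "f \<in> borel_measurable lebesgue"
    unfolding f_def by (rule measurable_completion) simp
  have "norm (f t) powr p = g t" for t
    using p(1) g_nonneg by (simp add: f_def powr_powr)
  then have f: "f \<in> Lp_space p"
    using g_int by (simp add: Lp_space_def integrable_completion)
  \<comment> \<open>For \<open>t\<close> in \<open>A n\<close> the product \<open>s n * t\<close>
    lies in \<open>[1, 2]\<close>, inside \<open>[0, pi]\<close>, so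
    \<open>1 - cos (s n * t) \<ge> 1 - cos 1 = 2 * c\<close>; dividing by
    \<open>t \<le> 2 / s n\<close> leaves \<open>c * s n\<close>.\<close>
  define c where "c = (1 - cos 1) / (2 :: real)"
  have "cos 1 < cos (0 :: real)" using pi_gt3 by (intro cos_monotone_0_pi) auto
  then have "c > 0" by (simp add: c_def)
  have Psi_ge: "norm (Psi f (s n)) \<ge> c * (1 / 2) ^ n * s n powr (1 / p)" for n
  proof -
    \<comment> \<open>A lower bound for \<open>f\<close> on \<open>A n\<close>; integrating
      \<open>c * s n * a\<close> over this interval of length \<open>1 / s n\<close> gives
      \<open>c * a\<close>.\<close>
    define a where "a = ((1 / 2) ^ n * s n) powr (1 / p)"
    have "a \<ge> 0" by (simp add: a_def)
    have int: "integrable lebesgue (\<lambda>t. Psi_kernel (s n) t * f t)"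
      using p f by (rule Psi_bound(1))
    have c_le: "c * s n \<le> - Im (Psi_kernel (s n) t)" if t: "t \<in> A n" for t
    proof -
      have sn: "s n > 0" by (rule s_pos)
      have st: "1 \<le> s n * t" "s n * t \<le> 2" using t sn by (auto simp: A_def field_simps)
      then have "t > 0" using sn by (smt (verit) mult_nonneg_nonpos)
      have "cos (s n * t) \<le> cos 1" using st pi_gt3 by (intro cos_monotone_0_pi_le) auto
      then have "c * s n * t \<le> c * 2" using st \<open>c > 0\<close> by simp
      also have "\<dots> \<le> 1 - cos (s n * t)" using \<open>cos (s n * t) \<le> cos 1\<close> by (simp add: c_def)
      finally show ?thesis using \<open>t > 0\<close> by (simp add: Im_Psi_kernel field_simps)
    qed
    have "c * a = (LINT t|lborel. c * s n * a * indicator (A n) t)"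
      using s_pos[of n] by (simp add: A_def divide_right_mono diff_divide_distrib[symmetric])
    also have "\<dots> = (LINT t|lebesgue. c * s n * a * indicator (A n) t)"
      by (rule integral_completion[symmetric]) simp
    also have "\<dots> \<le> (LINT t|lebesgue. - Im (Psi_kernel (s n) t * f t))"
    proof (rule integral_mono_AE)
      show "integrable lebesgue (\<lambda>t. c * s n * a * indicator (A n) t)"
        unfolding A_def by (subst integrable_completion) (auto intro!: integrable_real_indicator simp: emeasure_lborel_Icc_eq)
      show "integrable lebesgue (\<lambda>t. - Im (Psi_kernel (s n) t * f t))"
        by (rule Bochner_Integration.integrable_minus[OF integrable_Im[OF int]])
      have "AE t in lborel. c * s n * a * indicator (A n) t \<le> - Im (Psi_kernel (s n) t * f t)"
        using g_ge
      proof eventually_elim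
        case (elim t)
        have Im: "- Im (Psi_kernel (s n) t * f t) = - Im (Psi_kernel (s n) t) * g t powr (1 / p)"
          by (simp add: f_def)
        show ?case
        proof (cases "t \<in> A n")
          case True
          have "a \<le> g t powr (1 / p)" unfolding a_def
            using p(1) s_pos[of n] elim True by (intro powr_mono2) auto
          then have "(c * s n) * a \<le> - Im (Psi_kernel (s n) t) * g t powr (1 / p)"
            using c_le[OF True] \<open>a \<ge> 0\<close> order.trans[OF _ c_le[OF True], of 0] \<open>c > 0\<close> s_pos[of n]
            by (intro mult_mono) simp_all
          then show ?thesis using True Im by simp
        next
          case False
          have "0 \<le> - Im (Psi_kernel (s n) t) * g t powr (1 / p)"
          proof (cases "t \<le> 0")
            case False
            then show ?thesis by (intro mult_nonneg_nonneg) (simp_all only: Im_Psi_kernel, simp_all)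
          qed (simp add: g_neg)
          then show ?thesis using False Im by simp
        qed
      qed
      then show "AE t in lebesgue. c * s n * a * indicator (A n) t \<le> - Im (Psi_kernel (s n) t * f t)"
        by (rule AE_completion)
    qed
    also have "\<dots> = - Im (Psi f (s n))" by (simp only: Psi_def Bochner_Integration.integral_minus integral_Im[OF int])
    also have "\<dots> \<le> norm (Psi f (s n))" using abs_Im_le_cmod[of "Psi f (s n)"] by linarith
    finally have "c * a \<le> norm (Psi f (s n))" .
    \<comment> \<open>Since \<open>1 / p \<le> 1\<close>, taking this power of
      \<open>2^-n \<le> 1\<close> can only increase it.\<close>
    moreover have "(1 / 2) ^ n * s n powr (1 / p) \<le> a"
    proof -
      have "(1 / 2 :: real) ^ n = ((1 / 2) ^ n) powr 1" by simp
      also have "\<dots> \<le> ((1 / 2) ^ n) powr (1 / p)"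
        using p(1) by (intro powr_mono') (auto simp: power_le_one)
      finally show ?thesis unfolding a_def by (simp add: powr_mult mult_right_mono)
    qed
    then have "c * ((1 / 2) ^ n * s n powr (1 / p)) \<le> c * a"
      using \<open>c > 0\<close> by (intro mult_left_mono) auto
    ultimately show ?thesis by (simp add: mult.assoc)
  qed
  have ratio: "c * 2 ^ n \<le> norm (Psi f (s n) / of_real (\<psi> (s n)))" for n
  proof -
    have "c * 2 ^ n * \<psi> (s n) \<le> c * 2 ^ n * ((1 / 4) ^ n * s n powr (1 / p))"
      using \<psi>s[of n] \<open>c > 0\<close> by (intro mult_left_mono) auto
    also have "\<dots> = c * (2 ^ n * (1 / 4) ^ n) * s n powr (1 / p)" by (simp add: mult_ac)
    also have "(2 :: real) ^ n * (1 / 4) ^ n = (1 / 2) ^ n" by (simp flip: power_mult_distrib)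
    also have "c * (1 / 2) ^ n * s n powr (1 / p) \<le> norm (Psi f (s n))" by (rule Psi_ge)
    finally show ?thesis using \<psi>(1)[of "s n"] by (simp add: norm_divide field_simps)
  qed
  show "\<exists>f\<in>Lp_space p. \<not> Bfun (\<lambda>s. Psi f s / of_real (\<psi> s)) F"
  proof (intro bexI[OF _ f] notI)
    assume "Bfun (\<lambda>s. Psi f s / of_real (\<psi> s)) F"
    then obtain K where "eventually (\<lambda>s. norm (Psi f s / of_real (\<psi> s)) \<le> K) F"
      by (auto simp: Bfun_def)
    then have "eventually (\<lambda>n. norm (Psi f (s n) / of_real (\<psi> (s n))) \<le> K) sequentially"
      using s_lim by (auto simp: filterlim_iff)
    then obtain N where N: "\<And>n. n \<ge> N \<Longrightarrow> norm (Psi f (s n) / of_real (\<psi> (s n))) \<le> K"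
      by (auto simp: eventually_sequentially)
    obtain k where k: "K / c < 2 ^ k" using real_arch_pow[of 2 "K / c"] by auto
    have "c * 2 ^ (max N k) \<le> K" using ratio[of "max N k"] N[of "max N k"] by linarith
    moreover have "(2 :: real) ^ k \<le> 2 ^ (max N k)" by (rule power_increasing) auto
    then have "c * 2 ^ k \<le> c * 2 ^ max N k" using \<open>c > 0\<close> by (intro mult_left_mono) auto
    moreover have "K < c * 2 ^ k" using k \<open>c > 0\<close> by (simp add: field_simps)
    ultimately show False by linarith
  qed
qed

section \<open>Test sequences and optimality of the constant\<close>

lemma filterlim_Suc_at_infinity: "filterlim (\<lambda>n. real (Suc n)) at_infinity sequentially"
  by (rule filterlim_compose[OF filterlim_real_at_infinity_sequentially filterlim_Suc])

lemma filterlim_inverse_Suc_at_0: "filterlim (\<lambda>n. 1 / real (Suc n)) (at 0) sequentially"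
  using LIMSEQ_inverse_real_of_nat by (auto simp: filterlim_at inverse_eq_divide)

text \<open>A zero constant would make every transform vanish, contradicting sharpness of the order
  at infinity for \<open>\<psi> = 1\<close>. No estimate of the sine integral from below is
  involved.\<close>

lemma C_const_pos:
  assumes p: "1 \<le> p" "1 / ennreal p + 1 / q = 1"
  shows "C_const q > 0"
proof (rule ccontr)
  assume "\<not> C_const q > 0"
  then have "C_const q = 0" using C_const_nonneg[of q] by simp
  then have zero: "Psi f s = 0" if "f \<in> Lp_space p" for f s
    using Psi_bound(2)[OF p that, of s] by simp
  have "((\<lambda>s::real. norm s powr (- (1 / p))) \<longlongrightarrow> 0) at_infinity"
    using p(1) by (intro tendsto_neg_powr filterlim_norm_at_top) auto
  then have "(\<lambda>_. 1) \<in> o[at_infinity](\<lambda>s::real. \<bar>s\<bar> powr (1 / p))"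
    using eventually_not_equal_at_infinity[of "0 :: real"]
    by (intro smalloI_tendsto) (auto simp: powr_minus_divide elim: eventually_mono)
  moreover have "Psi_order_sharp p at_infinity"
    by (rule Psi_order_sharpI[OF p _ filterlim_Suc_at_infinity]) simp
  ultimately have "\<exists>f\<in>Lp_space p. \<not> Bfun (\<lambda>s. Psi f s / of_real 1) at_infinity"
    unfolding Psi_order_sharp_def by (elim allE[of _ "\<lambda>_. 1"] impE) simp_all
  then show False by (auto simp: zero)
qed

text \<open>The extremal function of Hoelder's inequality at \<open>s = 1\<close>: \<open>f\<close> is the conjugate of the kernel times \<open>\<bar>K\<bar>\<^sup>r\<^sup>-\<^sup>2\<close>.\<close>

proposition Psi_constant_sharp:
  assumes p: "1 < p" "1 / ennreal p + 1 / q = 1" and K: "K < C_const q"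
  shows "\<exists>f \<in> Lp_space p. \<exists>s. norm (Psi f s) > K * Lp_norm p f * \<bar>s\<bar> powr (1 / p)"
proof -
  obtain r where r: "r > 1" "q = ennreal r" "1 / p + 1 / r = 1"
    using conjugate_exponent p by blast
  define k where "k = Psi_kernel 1"
  have [measurable]: "k \<in> borel_measurable lebesgue" by (simp add: k_def)
  define f where "f t = cnj (k t) * of_real (norm (k t) powr (r - 2))" for t
  have [measurable]: "f \<in> borel_measurable lebesgue"
    unfolding f_def by (intro borel_measurable_times borel_measurable_of_real)
      (auto intro: measurable_compose[OF _ borel_measurable_continuous_onI[of cnj]] continuous_intros)
  note N = integral_Psi_kernel_powr[OF \<open>r > 1\<close>, of 1, folded k_def]
  define C where "C = C_const q"
  have "C > 0" using C_const_pos[of p q] p by (simp add: C_def)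
  \<comment> \<open>Conjugacy of the exponents; it makes \<open>|f|\<close> to the power
    \<open>p\<close> equal to \<open>|k|\<close> to the power \<open>r\<close>.\<close>
  have "(r - 1) * p = r"
    using r(1,3) p(1) by (simp add: field_simps)
  have norm_f: "norm (f t) = norm (k t) powr (r - 1)" for t
  proof (cases "k t = 0")
    case False
    then have "norm (f t) = norm (k t) powr 1 * norm (k t) powr (r - 2)"
      by (simp add: f_def norm_mult)
    also have "\<dots> = norm (k t) powr (r - 1)" unfolding powr_add[symmetric] by simp
    finally show ?thesis .
  qed (simp add: f_def)
  have f_p: "norm (f t) powr p = norm (k t) powr r" for t
    by (simp add: norm_f powr_powr \<open>(r - 1) * p = r\<close>)
  have kf: "k t * f t = of_real (norm (k t) powr r)" for t
  proof (cases "k t = 0")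
    case False
    have "k t * f t = of_real ((norm (k t))\<^sup>2 * norm (k t) powr (r - 2))"
      by (simp only: f_def of_real_mult complex_norm_square mult.assoc)
    also have "(norm (k t))\<^sup>2 * norm (k t) powr (r - 2) = norm (k t) powr 2 * norm (k t) powr (r - 2)"
      by simp
    also have "\<dots> = norm (k t) powr r" unfolding powr_add[symmetric] by simp
    finally show ?thesis .
  qed simp
  have f: "f \<in> Lp_space p" using N(1) by (simp add: Lp_space_def f_p)
  have norm: "Lp_norm p f = C powr (r - 1)"
  proof -
    have "r * (1 / p) = r - 1" using \<open>(r - 1) * p = r\<close> p(1) by (simp add: field_simps)
    then show ?thesis using \<open>C > 0\<close> N(2) by (simp add: Lp_norm_def f_p powr_powr C_def r(2))
  qed
  \<comment> \<open>The value \<open>C powr r\<close> is \<open>C\<close> times the norm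
    \<open>C powr (r - 1)\<close> of \<open>f\<close>, so the estimate is an equality at
    \<open>s = 1\<close>.\<close>
  have "Psi f 1 = of_real (C powr r)"
    unfolding Psi_def k_def[symmetric] kf using N(2) by (simp add: C_def r(2))
  then have "norm (Psi f 1) = C * C powr (r - 1)"
    using \<open>C > 0\<close> by (simp add: powr_diff)
  moreover have "K * C powr (r - 1) < C * C powr (r - 1)"
    using K \<open>C > 0\<close> by (simp add: C_def)
  ultimately have "norm (Psi f 1) > K * Lp_norm p f * \<bar>1\<bar> powr (1 / p)"
    by (simp add: norm)
  with f show ?thesis by blast
qed

section \<open>Limits of the quotient by \<open>s\<close> for integrable functions\<close>

text \<open>Dominated convergence with majorant \<open>|f|\<close>, since the kernel divided by
  \<open>s\<close> has modulus at most 1. It is phrased along sequences to serve both limits: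
  \<open>l = 1\<close> for \<open>s\<close> tending to 0 and \<open>l = 0\<close> at
  infinity.\<close>

lemma Psi_divide_limit_sequentially:
  assumes f: "integrable lebesgue f" and X: "\<And>n. X n \<noteq> 0"
    and lim: "\<And>t. t \<noteq> 0 \<Longrightarrow> (\<lambda>n. Psi_kernel (X n) t / of_real (X n)) \<longlonglongrightarrow> l"
  shows "(\<lambda>n. Psi f (X n) / of_real (X n)) \<longlonglongrightarrow> l * (LINT t|lebesgue. f t)"
proof -
  have [measurable]: "f \<in> borel_measurable lebesgue" using f by (rule borel_measurable_integrable)
  have "(\<lambda>n. LINT t|lebesgue. Psi_kernel (X n) t / of_real (X n) * f t) \<longlonglongrightarrow> (LINT t|lebesgue. l * f t)"
  proof (rule integral_dominated_convergence[where w = "\<lambda>t. norm (f t)"])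
    have "AE t in lebesgue. t \<noteq> (0 :: real)" using AE_lborel_singleton by (rule AE_completion)
    then show "AE t in lebesgue. (\<lambda>n. Psi_kernel (X n) t / of_real (X n) * f t) \<longlonglongrightarrow> l * f t"
      by eventually_elim (intro tendsto_mult lim tendsto_const)
    show "AE t in lebesgue. norm (Psi_kernel (X n) t / of_real (X n) * f t) \<le> norm (f t)" for n
    proof (rule AE_I2)
      fix t
      have "norm (Psi_kernel (X n) t / of_real (X n)) \<le> 1"
        using norm_Psi_kernel_le[of "X n" t] X[of n] by (simp add: norm_divide)
      then show "norm (Psi_kernel (X n) t / of_real (X n) * f t) \<le> norm (f t)"
        by (simp only: norm_mult mult_left_le_one_le norm_ge_zero)
    qed
  qed (simp_all add: f)
  then show ?thesis by (simp add: Psi_def)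
qed

lemma Psi_divide_tendsto_at_0:
  assumes "integrable lebesgue f"
  shows "((\<lambda>s. Psi f s / of_real s) \<longlongrightarrow> (LINT t|lebesgue. f t)) (at 0)"
proof -
  have "((\<lambda>s. Psi_kernel s t / of_real s) \<longlongrightarrow> 1) (at 0)" if "t \<noteq> 0" for t
  proof -
    \<comment> \<open>The quotient of the kernel by \<open>s\<close> is
      \<open>(exp w - 1) / w\<close>, so its limit is the derivative of \<open>exp\<close> at
      0.\<close>
    define w where "w s = - (\<i> * of_real s * of_real t)" for s
    have "(w \<longlongrightarrow> w 0) (at 0)" unfolding w_def by (intro tendsto_intros)
    then have "filterlim w (at 0) (at 0)"
      using that by (auto simp: filterlim_at w_def eventually_at_filter)
    then have "((\<lambda>s. (exp (w s) - 1) / w s) \<longlongrightarrow> 1) (at 0)"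
      by (rule filterlim_compose[OF lim_exp_minus_1])
    moreover have "(exp (w s) - 1) / w s = Psi_kernel s t / of_real s" for s
      using that by (cases "s = 0") (simp_all add: w_def Psi_kernel_def field_simps)
    ultimately show ?thesis by simp
  qed
  then show ?thesis
    using Psi_divide_limit_sequentially[OF assms, where l = 1]
    by (auto simp: tendsto_at_iff_sequentially o_def)
qed

text \<open>Moves limits at infinity to \<open>at 0\<close>, where convergence is tested on
  sequences.\<close>

lemma tendsto_at_infinity_iff_inverse:
  "(f \<longlongrightarrow> l) at_infinity \<longleftrightarrow> ((f \<circ> inverse) \<longlongrightarrow> l) (at (0 :: real))"
  by (simp add: tendsto_compose_filtermap at_to_infinity filtermap_filtermap)

text \<open>For fixed \<open>t \<noteq> 0\<close> the kernel is bounded by \<open>2 / |t|\<close>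
  uniformly in \<open>s\<close>, so division by \<open>s\<close> sends it to 0.\<close>

lemma Psi_divide_tendsto_at_infinity:
  assumes "integrable lebesgue f"
  shows "((\<lambda>s. Psi f s / of_real s) \<longlongrightarrow> 0) at_infinity"
proof -
  have inf: "((\<lambda>s. Psi_kernel s t / of_real s) \<longlongrightarrow> 0) at_infinity" if "t \<noteq> 0" for t
  proof (rule Lim_null_comparison)
    have "norm (Psi_kernel s t / of_real s) \<le> 2 / \<bar>t\<bar> * inverse (norm s)" for s
    proof -
      have "norm (Psi_kernel s t) \<le> 2 / \<bar>t\<bar>"
        using that by (simp add: norm_Psi_kernel abs_mult divide_right_mono)
      then show ?thesis
        unfolding norm_divide divide_inverse[of _ "norm (complex_of_real s)"]
        by (intro mult_mono) auto
    qed
    then show "\<forall>\<^sub>F s in at_infinity. norm (Psi_kernel s t / of_real s) \<le> 2 / \<bar>t\<bar> * inverse (norm s)"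
      by simp
    show "((\<lambda>s. 2 / \<bar>t\<bar> * inverse (norm s)) \<longlongrightarrow> 0) (at_infinity :: real filter)"
      by (intro tendsto_mult_right_zero tendsto_inverse_0_at_top filterlim_norm_at_top)
  qed
  have lim: "(((\<lambda>s. Psi_kernel s t / of_real s) \<circ> inverse) \<longlongrightarrow> 0) (at 0)" if "t \<noteq> 0" for t
    using inf[OF that] by (rule iffD1[OF tendsto_at_infinity_iff_inverse])
  have "(((\<lambda>s. Psi f s / of_real s) \<circ> inverse) \<longlongrightarrow> 0) (at 0)"
    unfolding tendsto_at_iff_sequentially
  proof (intro allI impI)
    fix X :: "nat \<Rightarrow> real" assume X: "\<forall>i. X i \<in> UNIV - {0}" "X \<longlonglongrightarrow> 0"
    have "(\<lambda>n. Psi f (inverse (X n)) / of_real (inverse (X n))) \<longlonglongrightarrow> 0 * (LINT t|lebesgue. f t)"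
    proof (rule Psi_divide_limit_sequentially[OF assms])
      show "(\<lambda>n. Psi_kernel (inverse (X n)) t / of_real (inverse (X n))) \<longlonglongrightarrow> 0" if "t \<noteq> 0" for t
        using lim[OF that] X unfolding tendsto_at_iff_sequentially o_def by blast
    qed (use X in simp)
    then show "(((\<lambda>s. Psi f s / of_real s) \<circ> inverse) \<circ> X) \<longlonglongrightarrow> 0" by (simp add: o_def)
  qed
  then show ?thesis by (rule iffD2[OF tendsto_at_infinity_iff_inverse])
qed

section \<open>Uniform continuity and the combined result\<close>

lemma Hoelder_continuous_imp_uniformly_continuous:
  assumes "Hoelder_continuous \<alpha> g" "\<alpha> > 0"
  shows "uniformly_continuous_on UNIV g"
proof -
  obtain C where C: "\<And>x y. norm (g x - g y) \<le> C * \<bar>x - y\<bar> powr \<alpha>"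
    using assms(1) by (auto simp: Hoelder_continuous_def)
  \<comment> \<open>A strictly positive constant, so that \<open>e / D\<close> below is a positive
    number.\<close>
  define D where "D = \<bar>C\<bar> + 1"
  have D: "D > 0" "norm (g x - g y) \<le> D * \<bar>x - y\<bar> powr \<alpha>" for x y
  proof -
    have "C * \<bar>x - y\<bar> powr \<alpha> \<le> D * \<bar>x - y\<bar> powr \<alpha>"
      by (rule mult_right_mono) (simp_all add: D_def)
    with C[of x y] show "norm (g x - g y) \<le> D * \<bar>x - y\<bar> powr \<alpha>" by linarith
  qed (simp add: D_def)
  show ?thesis
    unfolding uniformly_continuous_on_def
  proof (intro allI impI)
    fix e :: real assume "e > 0"
    define d where "d = (e / D) powr (1 / \<alpha>)"
    have "d > 0" using \<open>e > 0\<close> D(1) by (simp add: d_def)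
    moreover have "dist (g x') (g x) < e" if "dist x' x < d" for x x'
    proof -
      have "dist (g x') (g x) \<le> D * \<bar>x' - x\<bar> powr \<alpha>" using D(2) by (simp add: dist_norm)
      also have "\<bar>x' - x\<bar> powr \<alpha> < d powr \<alpha>"
        using that assms(2) by (intro powr_less_mono2) (auto simp: dist_real_def)
      also have "d powr \<alpha> = e / D" using \<open>e > 0\<close> D(1) assms(2) by (simp add: d_def powr_powr)
      finally show ?thesis using D(1) by simp
    qed
    ultimately show "\<exists>d>0. \<forall>x\<in>UNIV. \<forall>x'\<in>UNIV. dist x' x < d \<longrightarrow> dist (g x') (g x) < e" by blast
  qed
qed

text \<open>Sharpness for \<open>p = 1\<close> at 0 appears in two forms: the order cannot be
  improved, and for one \<open>f\<close> of positive norm the ratio to the bound tends to 1, so the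
  constant 1 cannot be lowered either.\<close>

theorem theorem2p1:
  fixes p :: real and q :: ennreal
  assumes "1 \<le> p" and "1 / ennreal p + 1 / q = 1"
  shows
    "(\<forall>f \<in> Lp_space p. \<forall>s.
        integrable lebesgue (\<lambda>t. Psi_kernel s t * f t) \<and>
        norm (Psi f s) \<le> C_const q * Lp_norm p f * \<bar>s\<bar> powr (1 / p))
   \<and> (1 < p \<longrightarrow>
        Psi_order_sharp p at_infinity
      \<and> Psi_order_sharp p (at 0)
      \<and> (\<forall>K < C_const q. \<exists>f \<in> Lp_space p. \<exists>s.
            norm (Psi f s) > K * Lp_norm p f * \<bar>s\<bar> powr (1 / p)))
   \<and> (p = 1 \<longrightarrow>
        (\<forall>f \<in> Lp_space 1. \<forall>s. norm (Psi f s) \<le> Lp_norm 1 f * \<bar>s\<bar>)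
      \<and> Psi_order_sharp 1 (at 0)
      \<and> (\<exists>f \<in> Lp_space 1. Lp_norm 1 f > 0 \<and>
            ((\<lambda>s. norm (Psi f s) / (Lp_norm 1 f * \<bar>s\<bar>)) \<longlongrightarrow> 1) (at 0))
      \<and> (\<forall>f \<in> Lp_space 1. Psi f \<in> o[at_infinity](\<lambda>s. of_real s)))
   \<and> (\<forall>f \<in> Lp_space p.
        Hoelder_continuous (1 / p) (Psi f)
      \<and> uniformly_continuous_on UNIV (Psi f)
      \<and> (p = 1 \<longrightarrow> (\<exists>L. L-lipschitz_on UNIV (Psi f))))"
proof (intro conjI impI ballI allI)
  note pq = assms
  {
    fix f assume f: "f \<in> Lp_space p"
    show "integrable lebesgue (\<lambda>t. Psi_kernel s t * f t)" for s
      using pq f by (rule Psi_bound)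
    show "norm (Psi f s) \<le> C_const q * Lp_norm p f * \<bar>s\<bar> powr (1 / p)" for s
      using pq f by (rule Psi_bound)
    show Hoelder: "Hoelder_continuous (1 / p) (Psi f)"
      unfolding Hoelder_continuous_def using norm_Psi_diff_le[OF pq f] by blast
    show "uniformly_continuous_on UNIV (Psi f)"
      using Hoelder pq(1) by (intro Hoelder_continuous_imp_uniformly_continuous) auto
    show "\<exists>L. L-lipschitz_on UNIV (Psi f)" if "p = 1"
      using norm_Psi_diff_le[OF pq f] that
      by (intro exI[of _ "C_const q * Lp_norm p f"] lipschitz_onI)
        (auto simp: dist_norm C_const_nonneg Lp_norm_nonneg)
  }
  show "Psi_order_sharp p at_infinity"
    by (rule Psi_order_sharpI[OF pq _ filterlim_Suc_at_infinity]) simp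
  show sharp_0: "Psi_order_sharp p (at 0)"
    by (rule Psi_order_sharpI[OF pq _ filterlim_inverse_Suc_at_0]) simp
  show "\<exists>f \<in> Lp_space p. \<exists>s. norm (Psi f s) > K * Lp_norm p f * \<bar>s\<bar> powr (1 / p)"
    if "1 < p" "K < C_const q" for K
    using that pq(2) by (intro Psi_constant_sharp) auto
  assume "p = 1"
  then show "Psi_order_sharp 1 (at 0)" using sharp_0 by simp
  have q: "q = \<infinity>" using pq(2) \<open>p = 1\<close> conjugate_exponent_1 by simp
  show "norm (Psi f s) \<le> Lp_norm 1 f * \<bar>s\<bar>" if "f \<in> Lp_space 1" for f s
    using Psi_bound(2)[of 1 q f s] pq that \<open>p = 1\<close> by (simp add: q C_const_def)
  show "Psi f \<in> o[at_infinity](\<lambda>s. of_real s)" if "f \<in> Lp_space 1" for f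
    using Psi_divide_tendsto_at_infinity[of f] that eventually_not_equal_at_infinity[of "0 :: real"]
    by (intro smalloI_tendsto) (auto simp: Lp_space_1)
  \<comment> \<open>For the indicator of \<open>[0, 1]\<close> the integral and the norm are both 1,
    so the limit of \<open>Psi f s / s\<close> at 0 attains the bound.\<close>
  define f :: "real \<Rightarrow> complex" where "f = (\<lambda>t. of_real (indicator {0..1} t))"
  have f: "integrable lebesgue f" "(LINT t|lebesgue. f t) = 1"
    by (simp_all add: f_def integrable_completion integral_completion)
  have "norm (f t) = indicator {0..1} t" for t by (simp add: f_def indicator_def)
  then have norm: "Lp_norm 1 f = 1" by (simp add: Lp_norm_1)
  have "((\<lambda>s. norm (Psi f s / of_real s)) \<longlongrightarrow> norm (1 :: complex)) (at 0)"
    using Psi_divide_tendsto_at_0[OF f(1)] unfolding f(2) by (rule tendsto_norm)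
  then have "((\<lambda>s. norm (Psi f s) / (Lp_norm 1 f * \<bar>s\<bar>)) \<longlongrightarrow> 1) (at 0)"
    by (simp add: norm norm_divide)
  with norm f(1) show "\<exists>f \<in> Lp_space 1. Lp_norm 1 f > 0 \<and>
      ((\<lambda>s. norm (Psi f s) / (Lp_norm 1 f * \<bar>s\<bar>)) \<longlongrightarrow> 1) (at 0)"
    by (intro bexI[of _ f]) (simp_all add: Lp_space_1)
qed

end
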